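(* Let $w_1,w_2,w_3$ be positive integers such that $r$ divides none of $w_2w_3$, $w_1w_3$, $w_1w_2$. Then for every integer $n\ge 0$, $$\begin{aligned} &\sum_{k+l+m=n}\binom{n}{k,l,m}S_k(dw_1-1;\chi,\xi^{w_3})\,S_l(dw_2-1;\chi,\xi^{w_1})\,S_m(dw_3-1;\chi,\xi^{w_2})\,w_3^{k}w_1^{l}w_2^{m}\\ &=\sum_{k+l+m=n}\binom{n}{k,l,m}S_k(dw_1-1;\chi,\xi^{w_2})\,S_l(dw_3-1;\chi,\xi^{w_1})\,S_m(dw_2-1;\chi,\xi^{w_3})\,w_2^{k}w_1^{l}w_3^{m}. \end{aligned}$$
   Context: Let $p$ be a prime, $\mathbb{C}_p$ the completion of an algebraic closure of $\mathbb{Q}_p$, $d$ a positive integer, and $\chi$ a primitive Dirichlet character of conductor $d$, with values viewed in $\mathbb{C}_p$ via a fixed embedding $\overline{\mathbb{Q}}\to\mathbb{C}_p$ (as usual $\chi(a)=0$ if $\gcd(a,d)>1$; for $d=1$, $\chi\equiv 1$). Let $r$ be a positive integer with $\gcd(r,pd)=1$ and let $\xi\neq 1$ in $\mathbb{C}_p$ be an $r$-th root of unity. For a root of unity $\eta\in\mathbb{C}_p$ and integers $k,m\ge 0$, the generalized twisted power sum is $S_k(m;\chi,\eta)=\sum_{a=0}^{m}\chi(a)\eta^{a}a^{k}$, with the convention $0^0=1$. Sums over $k+l+m=n$ run over all nonnegative integers $k,l,m$ with $k+l+m=n$, and $\binom{n}{k,l,m}=\frac{n!}{k!\,l!\,m!}$.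 *)

theory Defs
  imports "HOL-Analysis.Analysis" "HOL-Computational_Algebra.Polynomial" "HOL-Computational_Algebra.Primes"
begin

definition abs_value :: "('a::field \<Rightarrow> real) \<Rightarrow> bool" where
  "abs_value v \<longleftrightarrow>
     (\<forall>x. 0 \<le> v x) \<and> (\<forall>x. v x = 0 \<longleftrightarrow> x = 0) \<and>
     (\<forall>x y. v (x * y) = v x * v y) \<and> (\<forall>x y. v (x + y) \<le> v x + v y)"

definition abs_dist :: "('a::field \<Rightarrow> real) \<Rightarrow> 'a \<Rightarrow> 'a \<Rightarrow> real" where
  "abs_dist v x y = v (x - y)"

lemma abs_value_Metric_space:
  assumes "abs_value v"
  shows "Metric_space K (abs_dist v)"
proof -
  have nn: "0 \<le> v x" and z: "v x = 0 \<longleftrightarrow> x = 0" and m: "v (x * y) = v x * v y"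
    and t: "v (x + y) \<le> v x + v y" for x y
    using assms by (auto simp: abs_value_def)
  have "v 1 = 1" using m[of 1 1] z[of 1] by simp
  then have "v (- 1) * v (- 1) = 1" using m[of "- 1" "- 1"] by simp
  then have "v (- 1) = 1" using nn[of "- 1"]
    by (metis abs_of_nonneg abs_square_eq_1 power2_eq_square)
  then have sym: "v (x - y) = v (y - x)" for x y
    using m[of "- 1" "y - x"] by simp
  show ?thesis
    by unfold_locales (use nn z sym t[of "_ - _" "_ - _"] in \<open>auto simp: abs_dist_def\<close>, 
       metis t diff_add_cancel add_diff_eq)
qed

text \<open>The p-adic absolute value on the rationals, normalised so that \<open>p\<close> has value \<open>1/p\<close>.\<close>

definition padic_abs :: "nat \<Rightarrow> rat \<Rightarrow> real" where
  "padic_abs p q = (if q = 0 then 0 else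
     (let (a, b) = quotient_of q in
        real p powi (int (multiplicity (int p) b) - int (multiplicity (int p) a))))"

definition is_subfield :: "'a::field set \<Rightarrow> bool" where
  "is_subfield F \<longleftrightarrow> 0 \<in> F \<and> 1 \<in> F \<and>
     (\<forall>x\<in>F. \<forall>y\<in>F. x - y \<in> F \<and> x * y \<in> F) \<and> (\<forall>x\<in>F. inverse x \<in> F)"

definition is_completion :: "('a::field \<Rightarrow> real) \<Rightarrow> 'a set \<Rightarrow> 'a set \<Rightarrow> bool" where
  "is_completion v F K \<longleftrightarrow>
     is_subfield F \<and> is_subfield K \<and> F \<subseteq> K \<and>
     Metric_space.mcomplete K (abs_dist v) \<and>
     Metric_space.mtopology K (abs_dist v) closure_of F = K"

definition is_algebraic_closure :: "'a::field set \<Rightarrow> 'a set \<Rightarrow> bool" where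
  "is_algebraic_closure F K \<longleftrightarrow>
     is_subfield F \<and> is_subfield K \<and> F \<subseteq> K \<and>
     (\<forall>x\<in>K. \<exists>f. set (coeffs f) \<subseteq> F \<and> f \<noteq> 0 \<and> poly f x = 0) \<and>
     (\<forall>f. set (coeffs f) \<subseteq> K \<and> degree f > 0 \<longrightarrow> (\<exists>x\<in>K. poly f x = 0))"

text \<open>
  The type \<open>'a\<close> with the absolute value \<open>v\<close> is a copy of the completion of an algebraic closure
  \<open>A\<close> of the field \<open>Q\<close> of p-adic numbers, where \<open>Q\<close> is the completion of the prime field under
  the p-adic absolute value. The intermediate fields are identified with their images in \<open>'a\<close>;
  the absolute value on \<open>A\<close> is an extension, hence the unique one, of that on \<open>Q\<close>.
\<close>

definition padic_complex_field :: "nat \<Rightarrow> ('a::field_char_0 \<Rightarrow> real) \<Rightarrow> bool" where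
  "padic_complex_field p v \<longleftrightarrow>
     prime p \<and> abs_value v \<and> (\<forall>q. v (of_rat q) = padic_abs p q) \<and>
     (\<exists>Q A. is_completion v (range of_rat) Q \<and> is_algebraic_closure Q A \<and>
            is_completion v A UNIV)"

text \<open>
  The field of algebraic numbers is \<open>{z :: complex. algebraic z}\<close>; an embedding of it is a total
  function on the complex numbers whose values elsewhere are irrelevant. Injectivity follows.
\<close>

definition algebraic_embedding :: "(complex \<Rightarrow> 'a::field) \<Rightarrow> bool" where
  "algebraic_embedding \<iota> \<longleftrightarrow>
     \<iota> 1 = 1 \<and>
     (\<forall>x y. algebraic x \<and> algebraic y \<longrightarrow>
        \<iota> (x + y) = \<iota> x + \<iota> y \<and> \<iota> (x * y) = \<iota> x * \<iota> y)"

definition dirichlet_character :: "nat \<Rightarrow> (nat \<Rightarrow> complex) \<Rightarrow> bool" where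
  "dirichlet_character d chi \<longleftrightarrow>
     d > 0 \<and> (\<forall>a. chi (a + d) = chi a) \<and> (\<forall>a b. chi (a * b) = chi a * chi b) \<and>
     (\<forall>a. chi a \<noteq> 0 \<longleftrightarrow> coprime a d)"

definition induced_from :: "nat \<Rightarrow> (nat \<Rightarrow> complex) \<Rightarrow> nat \<Rightarrow> bool" where
  "induced_from d chi f \<longleftrightarrow>
     f dvd d \<and> (\<exists>\<psi>. dirichlet_character f \<psi> \<and> (\<forall>a. coprime a d \<longrightarrow> chi a = \<psi> a))"

definition conductor :: "nat \<Rightarrow> (nat \<Rightarrow> complex) \<Rightarrow> nat" where
  "conductor d chi = (LEAST f. induced_from d chi f)"

definition primitive_character :: "nat \<Rightarrow> (nat \<Rightarrow> complex) \<Rightarrow> bool" where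
  "primitive_character d chi \<longleftrightarrow> dirichlet_character d chi \<and> conductor d chi = d"

definition twisted_power_sum :: "nat \<Rightarrow> nat \<Rightarrow> (nat \<Rightarrow> 'a::field_char_0) \<Rightarrow> 'a \<Rightarrow> 'a" where
  "twisted_power_sum k m chi \<eta> = (\<Sum>a=0..m. chi a * \<eta> ^ a * of_nat a ^ k)"

definition trinomial :: "nat \<Rightarrow> nat \<Rightarrow> nat \<Rightarrow> nat \<Rightarrow> 'a::field_char_0" where
  "trinomial n k l m = fact n / (fact k * fact l * fact m)"

end

theory Submission
  imports Defs
begin

text \<open>
  Put \<open>F\<^sub>w(N) = \<Sum>a<N. \<chi>(a) X^(w a)\<close>. By the multinomial theorem both sides of the identity are values
  at \<open>\<xi>\<close> of \<open>(X d/dX)^n\<close> applied to a product of three such polynomials. Periodicity of \<open>\<chi>\<close> gives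
  \<open>(X^(w d) - 1) F\<^sub>w(d M) = (X^(w d M) - 1) F\<^sub>w(d)\<close>, so that, after multiplication by the nonzero
  polynomial \<open>(X^(w\<^sub>1 d) - 1) (X^(w\<^sub>2 d) - 1) (X^(w\<^sub>3 d) - 1)\<close>, the two products become the same
  expression.
\<close>

text \<open>The binomial theorem applied twice, to \<open>x + (y + z)\<close> and then to
  \<open>y + z\<close>: in the product of the two binomial coefficients \<open>(n - k)!\<close>
  cancels. The triples are the pairs \<open>(k, l)\<close> with
  \<open>m = n - k - l\<close>.\<close>

lemma trinomial_theorem:
  fixes x y z :: "'a::field_char_0"
  shows "(\<Sum>(k, l, m) \<in> {(k, l, m). k + l + m = n}. trinomial n k l m * x ^ k * y ^ l * z ^ m)
    = (x + y + z) ^ n"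
proof -
  have "(x + y + z) ^ n = (\<Sum>k\<le>n. of_nat (n choose k) * x ^ k * (y + z) ^ (n - k))"
    using binomial_ring[of x "y + z" n] by (simp add: add.assoc)
  also have "\<dots> = (\<Sum>k\<le>n. \<Sum>l\<le>n - k. trinomial n k l (n - k - l) * x ^ k * y ^ l * z ^ (n - k - l))"
  proof (rule sum.cong)
    fix k assume "k \<in> {..n}"
    then have "of_nat (n choose k) * of_nat ((n - k) choose l) = (trinomial n k l (n - k - l) :: 'a)"
      if "l \<le> n - k" for l
      using that by (simp add: trinomial_def binomial_fact)
    then show "of_nat (n choose k) * x ^ k * (y + z) ^ (n - k) =
        (\<Sum>l\<le>n - k. trinomial n k l (n - k - l) * x ^ k * y ^ l * z ^ (n - k - l))"
      by (auto simp: binomial_ring[of y z] sum_distrib_left mult_ac intro!: sum.cong)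
  qed simp
  also have "\<dots> = (\<Sum>(k, l) \<in> (SIGMA k:{..n}. {..n - k}).
      trinomial n k l (n - k - l) * x ^ k * y ^ l * z ^ (n - k - l))"
    by (simp add: sum.Sigma)
  also have "\<dots> = (\<Sum>(k, l, m) \<in> {(k, l, m). k + l + m = n}.
      trinomial n k l m * x ^ k * y ^ l * z ^ m)"
    by (rule sum.reindex_bij_witness[of _ "\<lambda>(k, l, m). (k, l)" "\<lambda>(k, l). (k, l, n - k - l)"]) auto
  finally show ?thesis by simp
qed

text \<open>The operator \<open>X d/dX\<close>; \<open>pCons 0\<close> is multiplication by
  \<open>X\<close>.\<close>

definition euler_op :: "'a::idom poly \<Rightarrow> 'a poly"
  where "euler_op q = pCons 0 (pderiv q)"

lemma euler_op_monom: "euler_op (monom c j) = monom (c * of_nat j) j"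
  by (cases j) (simp_all add: euler_op_def pderiv_monom mult.commute flip: monom_Suc)

text \<open>Monomials are eigenvectors with their exponent as eigenvalue. The case
  \<open>j = 0\<close>, \<open>n = 0\<close> agrees with the convention
  \<open>0^0 = 1\<close>.\<close>

lemma funpow_euler_op_monom: "(euler_op ^^ n) (monom c j) = monom (c * of_nat j ^ n) j"
  by (induction n) (simp_all add: euler_op_monom mult_ac)

lemma funpow_euler_op_sum:
  fixes f :: "'b \<Rightarrow> 'a::idom poly"
  shows "(euler_op ^^ n) (sum f A) = (\<Sum>x\<in>A. (euler_op ^^ n) (f x))"
proof (induction n)
  case (Suc n)
  have "pCons 0 (p + q) = pCons 0 p + pCons 0 q" for p q :: "'a poly"
    by simp
  then have "pCons 0 (sum g A) = (\<Sum>x\<in>A. pCons 0 (g x))" for g :: "'b \<Rightarrow> 'a poly"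
    by (induction A rule: infinite_finite_induct) (simp_all del: add_pCons)
  then show ?case
    using Suc by (simp add: euler_op_def higher_pderiv_sum[of 1, simplified])
qed simp

text \<open>Kept as a polynomial rather than a value at a root of unity, so that
  \<open>euler_op\<close> can act on it and factors \<open>X^k - 1\<close> with \<open>k > 0\<close>
  can be cancelled.\<close>

definition char_poly_sum :: "(nat \<Rightarrow> 'a::idom) \<Rightarrow> nat \<Rightarrow> nat \<Rightarrow> 'a poly"
  where "char_poly_sum f w N = (\<Sum>a<N. monom (f a) (w * a))"

text \<open>A geometric series in disguise: the range splits into \<open>M\<close> blocks of length
  \<open>d\<close>, and by periodicity block number \<open>i\<close>, counted from 0, is
  \<open>X^(w d i)\<close> times the first one. The induction adds one block at a time.\<close>

lemma char_poly_sum_periodic: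
  fixes f :: "nat \<Rightarrow> 'a::idom"
  assumes per: "\<And>a. f (a + d) = f a"
  shows "(monom 1 (w * d) - 1) * char_poly_sum f w (d * M)
    = (monom 1 (w * d * M) - 1) * char_poly_sum f w d"
proof (induction M)
  case 0
  then show ?case by (simp add: char_poly_sum_def)
next
  case (Suc M)
  have per': "f (d * M + a) = f a" for a
    by (induction M) (simp_all add: per add.commute add.left_commute, metis per add.assoc add.commute)
  have split: "sum h {..<N + k} = sum h {..<N} + (\<Sum>a<k. h (N + a))"
    for h :: "nat \<Rightarrow> 'a poly" and N k
    by (induction k) (simp_all add: add.assoc)
  have "char_poly_sum f w (d * Suc M)
      = char_poly_sum f w (d * M) + (\<Sum>a<d. monom (f (d * M + a)) (w * (d * M + a)))"
    using split[of "\<lambda>a. monom (f a) (w * a)" "d * M" d] by (simp add: char_poly_sum_def add.commute)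
  also have "(\<Sum>a<d. monom (f (d * M + a)) (w * (d * M + a)))
      = monom 1 (w * d * M) * char_poly_sum f w d"
    unfolding per' by (simp add: char_poly_sum_def sum_distrib_left mult_monom algebra_simps)
  finally have step: "char_poly_sum f w (d * Suc M)
      = char_poly_sum f w (d * M) + monom 1 (w * d * M) * char_poly_sum f w d" .
  have "monom 1 (w * d * Suc M) = monom 1 (w * d) * (monom 1 (w * d * M) :: 'a poly)"
    by (simp add: mult_monom algebra_simps)
  then show ?case
    unfolding step distrib_left Suc by (simp add: algebra_simps)
qed

lemma monom_minus_one_neq_0: "k > 0 \<Longrightarrow> monom 1 k - 1 \<noteq> (0 :: 'a::idom poly)"
  by (metis degree_1 degree_monom_eq diff_eq_eq add_0 less_irrefl one_neq_zero)

text \<open>Clearing denominators turns a factor with parameters \<open>w\<close> and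
  \<open>d * M\<close> into \<open>X^(w d M) - 1\<close> times \<open>char_poly_sum f w d\<close>.
  The first part is symmetric in \<open>w\<close> and \<open>M\<close>, and both sides run through
  the same three unordered pairs \<open>{w, M}\<close>; the second parts are the same three on both
  sides.\<close>

lemma char_poly_sum_prod_symmetric:
  fixes f :: "nat \<Rightarrow> 'a::idom"
  assumes per: "\<And>a. f (a + d) = f a" and pos: "d > 0" "w1 > 0" "w2 > 0" "w3 > 0"
  shows "char_poly_sum f w3 (d * w1) * char_poly_sum f w1 (d * w2) * char_poly_sum f w2 (d * w3)
    = char_poly_sum f w2 (d * w1) * char_poly_sum f w1 (d * w3) * char_poly_sum f w3 (d * w2)"
    (is "?L = ?R")
proof -
  define q where "q w = (monom 1 (w * d) - 1 :: 'a poly)" for w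
  define Q where "Q u w = (monom 1 (u * d * w) - 1 :: 'a poly)" for u w
  note P = char_poly_sum_periodic[of f d, OF per, folded q_def Q_def]
  have Q_sym: "Q u w = Q w u" for u w
    by (simp add: Q_def mult_ac)
  have "q w1 * q w2 * q w3 * ?L
      = (q w3 * char_poly_sum f w3 (d * w1)) * (q w1 * char_poly_sum f w1 (d * w2))
        * (q w2 * char_poly_sum f w2 (d * w3))"
    by (simp only: mult_ac)
  also have "\<dots> = (q w2 * char_poly_sum f w2 (d * w1)) * (q w1 * char_poly_sum f w1 (d * w3))
        * (q w3 * char_poly_sum f w3 (d * w2))"
    \<comment> \<open>These instances of \<open>Q_sym\<close> write each of the three pairs in one
      fixed order, after which the two products differ only by commutativity.\<close>
    unfolding P Q_sym[of w3 w1] Q_sym[of w2 w1] Q_sym[of w3 w2] by (simp only: mult_ac)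
  also have "\<dots> = q w1 * q w2 * q w3 * ?R"
    by (simp only: mult_ac)
  finally have "q w1 * q w2 * q w3 * ?L = q w1 * q w2 * q w3 * ?R" .
  moreover have "q w \<noteq> 0" if "w > 0" for w
    unfolding q_def using that pos by (intro monom_minus_one_neq_0) simp
  ultimately show ?thesis
    using pos by simp
qed

text \<open>The weight \<open>u^k\<close> turns \<open>a^k\<close> into \<open>(u a)^k\<close>, so
  summing over \<open>k\<close>, \<open>l\<close>, \<open>m\<close> first yields
  \<open>(u a + v b + w c)^n\<close>. This is the eigenvalue of \<open>euler_op ^^ n\<close> on the
  monomial that \<open>a\<close>, \<open>b\<close>, \<open>c\<close> contribute to the
  product.\<close>

lemma twisted_power_sum_convolution:
  fixes f :: "nat \<Rightarrow> 'a::field_char_0"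
  assumes pos: "A > 0" "B > 0" "C > 0"
  shows "(\<Sum>(k, l, m) \<in> {(k, l, m). k + l + m = n}.
      trinomial n k l m * twisted_power_sum k (A - 1) f (\<xi> ^ u) *
      twisted_power_sum l (B - 1) f (\<xi> ^ v) * twisted_power_sum m (C - 1) f (\<xi> ^ w) *
      of_nat u ^ k * of_nat v ^ l * of_nat w ^ m)
    = poly ((euler_op ^^ n) (char_poly_sum f u A * char_poly_sum f v B * char_poly_sum f w C)) \<xi>"
    (is "?L = ?R")
proof -
  \<comment> \<open>The part of each term that is independent of \<open>k\<close>, \<open>l\<close>,
    \<open>m\<close>.\<close>
  define g where "g a b c = f a * f b * f c * \<xi> ^ (u * a + v * b + w * c)" for a b c
  have tps: "twisted_power_sum k (N - 1) f (\<xi> ^ u) * of_nat u ^ k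
      = (\<Sum>a<N. f a * \<xi> ^ (u * a) * of_nat (u * a) ^ k)" if "N > 0" for k N u
  proof -
    \<comment> \<open>Positivity of \<open>N\<close> matters: subtraction truncates, so
      \<open>N = 0\<close> would leave the index 0 on the left.\<close>
    have "{0..N - 1} = {..<N}" using that by auto
    moreover have "(\<xi> ^ u) ^ a = \<xi> ^ (u * a)" for a
      by (simp add: power_mult)
    ultimately show ?thesis
      by (simp add: twisted_power_sum_def sum_distrib_left power_mult_distrib mult_ac)
  qed
  have swap: "(\<Sum>p\<in>S. \<Sum>a<A. \<Sum>b<B. \<Sum>c<C. h a b c p) = (\<Sum>a<A. \<Sum>b<B. \<Sum>c<C. \<Sum>p\<in>S. h a b c p)"
    for S :: "(nat \<times> nat \<times> nat) set" and h :: "nat \<Rightarrow> nat \<Rightarrow> nat \<Rightarrow> nat \<times> nat \<times> nat \<Rightarrow> 'a"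
    by (simp only: sum.swap[where A = S])
  have summand: "trinomial n k l m * twisted_power_sum k (A - 1) f (\<xi> ^ u) *
      twisted_power_sum l (B - 1) f (\<xi> ^ v) * twisted_power_sum m (C - 1) f (\<xi> ^ w) *
      of_nat u ^ k * of_nat v ^ l * of_nat w ^ m = (\<Sum>a<A. \<Sum>b<B. \<Sum>c<C.
      g a b c * (trinomial n k l m * of_nat (u * a) ^ k * of_nat (v * b) ^ l * of_nat (w * c) ^ m))"
    (is "?S = ?T") for k l m
  proof -
    \<comment> \<open>Each power sum is put beside its weight, so that \<open>tps\<close> applies;
      nesting to the right makes the expanded sums run over \<open>a\<close>, \<open>b\<close>,
      \<open>c\<close> in this order.\<close>
    have "?S = trinomial n k l m * ((twisted_power_sum k (A - 1) f (\<xi> ^ u) * of_nat u ^ k) *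
        ((twisted_power_sum l (B - 1) f (\<xi> ^ v) * of_nat v ^ l) *
        (twisted_power_sum m (C - 1) f (\<xi> ^ w) * of_nat w ^ m)))"
      by (simp only: mult_ac)
    also have "\<dots> = ?T"
      unfolding tps[OF pos(1)] tps[OF pos(2)] tps[OF pos(3)]
      unfolding sum_product
      unfolding sum_distrib_left
      by (simp only: g_def power_add mult_ac)
    finally show ?thesis .
  qed
  have "?L = (\<Sum>(k, l, m) \<in> {(k, l, m). k + l + m = n}. \<Sum>a<A. \<Sum>b<B. \<Sum>c<C.
      g a b c * (trinomial n k l m * of_nat (u * a) ^ k * of_nat (v * b) ^ l * of_nat (w * c) ^ m))"
    by (simp only: summand)
  also have "\<dots> = (\<Sum>a<A. \<Sum>b<B. \<Sum>c<C. g a b c *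
      (\<Sum>(k, l, m) \<in> {(k, l, m). k + l + m = n}.
        trinomial n k l m * of_nat (u * a) ^ k * of_nat (v * b) ^ l * of_nat (w * c) ^ m))"
    unfolding case_prod_unfold sum_distrib_left by (rule swap)
  also have "\<dots> = (\<Sum>a<A. \<Sum>b<B. \<Sum>c<C. g a b c * of_nat (u * a + v * b + w * c) ^ n)"
    unfolding trinomial_theorem by simp
  also have "\<dots> = ?R"
  proof -
    have "char_poly_sum f u A * char_poly_sum f v B * char_poly_sum f w C
        = (\<Sum>a<A. \<Sum>b<B. \<Sum>c<C. monom (f a * f b * f c) (u * a + v * b + w * c))"
      unfolding char_poly_sum_def mult.assoc
      unfolding sum_product
      unfolding sum_distrib_left by (simp add: mult_monom add.assoc)
    then show ?thesis
      by (simp add: g_def funpow_euler_op_sum funpow_euler_op_monom poly_sum poly_monom mult_ac)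
  qed
  finally show ?thesis .
qed

theorem theorem11:
  fixes p d r n w1 w2 w3 :: nat
    and v :: "'a::field_char_0 \<Rightarrow> real"
    and \<iota> :: "complex \<Rightarrow> 'a"
    and chi :: "nat \<Rightarrow> complex"
    and \<xi> :: 'a
  assumes "prime p"
    and "padic_complex_field p v"
    and "algebraic_embedding \<iota>"
    and "d > 0" and "primitive_character d chi"
    and "r > 0" and "coprime r (p * d)"
    and "\<xi> ^ r = 1" and "\<xi> \<noteq> 1"
    and "w1 > 0" and "w2 > 0" and "w3 > 0"
    and "\<not> r dvd w2 * w3" and "\<not> r dvd w1 * w3" and "\<not> r dvd w1 * w2"
  shows
    "(\<Sum>(k, l, m) \<in> {(k, l, m). k + l + m = n}.
        trinomial n k l m *
        twisted_power_sum k (d * w1 - 1) (\<iota> \<circ> chi) (\<xi> ^ w3) *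
        twisted_power_sum l (d * w2 - 1) (\<iota> \<circ> chi) (\<xi> ^ w1) *
        twisted_power_sum m (d * w3 - 1) (\<iota> \<circ> chi) (\<xi> ^ w2) *
        of_nat w3 ^ k * of_nat w1 ^ l * of_nat w2 ^ m)
   = (\<Sum>(k, l, m) \<in> {(k, l, m). k + l + m = n}.
        trinomial n k l m *
        twisted_power_sum k (d * w1 - 1) (\<iota> \<circ> chi) (\<xi> ^ w2) *
        twisted_power_sum l (d * w3 - 1) (\<iota> \<circ> chi) (\<xi> ^ w1) *
        twisted_power_sum m (d * w2 - 1) (\<iota> \<circ> chi) (\<xi> ^ w3) *
        of_nat w2 ^ k * of_nat w1 ^ l * of_nat w3 ^ m)"
proof -
  have "chi (a + d) = chi a" for a
    using \<open>primitive_character d chi\<close>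
    by (simp add: primitive_character_def dirichlet_character_def)
  then have per: "(\<iota> \<circ> chi) (a + d) = (\<iota> \<circ> chi) a" for a
    by simp
  have dw: "d * w1 > 0" "d * w2 > 0" "d * w3 > 0"
    using \<open>d > 0\<close> \<open>w1 > 0\<close> \<open>w2 > 0\<close> \<open>w3 > 0\<close> by simp_all
  show ?thesis
    \<comment> \<open>On the right-hand side the ranges come in the order \<open>w1\<close>,
      \<open>w3\<close>, \<open>w2\<close>, hence the permuted \<open>dw\<close>. What remains is
      the same operator and evaluation at \<xi> applied to two equal products.\<close>
    unfolding twisted_power_sum_convolution[OF dw] twisted_power_sum_convolution[OF dw(1,3,2)]
    using char_poly_sum_prod_symmetric[of "\<iota> \<circ> chi", OF per]
      \<open>d > 0\<close> \<open>w1 > 0\<close> \<open>w2 > 0\<close> \<open>w3 > 0\<close> by simp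
qed

end
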